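(* Let $f=(f_1,f_2)$ be a Keller map with a component $V$ of its finiteness variety, let $x_1=u^m$, $x_2=\sum_{i=0}^{N-1}h_iu^{m-i}+\gamma u^{m-N}$ be the associated $u$-$\gamma$ representation (see context), write $f(\hat C(\gamma,u))=(a(\gamma,u),b(\gamma,u))$, and put $\psi_1=\frac{\partial b}{\partial\gamma}$, $b_u=\frac{\partial b}{\partial u}$ and $L=N-m$. Along a trajectory $(x_1(r),x_2(r))$ of the system $$\frac{dx_1}{dr} = \frac{\partial f_2}{\partial x_2},\qquad \frac{dx_2}{dr} = - \frac{\partial f_2}{\partial x_1},$$ written in terms of $u$ and $\gamma$ (for a chosen branch of $u$), one has $$\frac{du}{dr} = \frac{1}{m}u^{L-m + 1}\psi_1 \qquad\text{and}\qquad \frac{d\gamma}{dr} = -\frac{1}{m}u^{L-m+1}b_u.$$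
   Context: Work over $\mathbf{C}$. $f=(f_1,f_2):X_0=\mathbf{A}^2\to Y_0=\mathbf{A}^2$ is a Keller map (polynomial, Jacobian determinant identically $1$). $V_f\subset Y_0$ is the set of points over which $f$ is not proper, and $V$ is an irreducible (codimension one) component. $X=\mathbf{P}^2\supset X_0$. $\hat X\to X$ is a composition of point blowups over the line at infinity, and $\Gamma\subset \hat X$ is an irreducible curve over infinity such that $f$ extends to a rational map on $\hat X$ that is defined almost everywhere on $\Gamma$ and maps $\Gamma$ densely onto $V$. Coordinates are chosen so that $\Gamma$ maps to a point $[1:\alpha:0]$ of the line at infinity. The $u$-$\gamma$ representation: $m\ge1$ is the order of vanishing of $1/x_1$ along $\Gamma$. Choose locally near a generic point of $\Gamma$ a function $s$ with $s^m=1/x_1$, and expand $x_2/x_1=\sum_{i\ge0}\beta_i s^i$ with $\beta_i$ local functions on $\Gamma$. $N$ is the first index with $\beta_N$ nonconstant, $h_i=\beta_i\in\mathbf{C}$ for $i<N$, $\gamma$ is the parameter given by $\beta_N$, and $u=s^{-1}$. Truncating after index $N$ gives $$\hat C(\gamma,u)=\Big(u^m,\ \textstyle\sum_{i=0}^{N-1}h_iu^{m-i}+\gamma u^{m-N}\Big),$$ and $f(\hat C(\gamma,u))=(a(\gamma,u),b(\gamma,u))$ with $a,b$ polynomials in $\gamma$ and $u^{-1}$. Given $(x_1,x_2)$ with $x_1\neq0$ and a branch $u$ of $x_1^{1/m}$, the equations $(x_1,x_2)=\hat C(\gamma,u)$ determine $\gamma$. *)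

theory Defs
  imports "HOL-Complex_Analysis.Complex_Analysis" "HOL-Computational_Algebra.Polynomial"
begin

section \<open>Polynomial maps of the affine plane\<close>

text \<open>An element of \<^typ>\<open>complex poly poly\<close> is a polynomial in two variables. The outer
  variable is the first one: the coefficient of its \<open>i\<close>-th power is a polynomial in the second.\<close>

definition eval2 :: "complex poly poly \<Rightarrow> complex \<times> complex \<Rightarrow> complex" where
  "eval2 p = (\<lambda>(x, y). poly (poly p [:x:]) y)"

definition pd1 :: "complex poly poly \<Rightarrow> complex poly poly" where
  "pd1 p = pderiv p"

definition pd2 :: "complex poly poly \<Rightarrow> complex poly poly" where
  "pd2 p = map_poly pderiv p"

definition pmap :: "complex poly poly \<Rightarrow> complex poly poly \<Rightarrow> complex \<times> complex \<Rightarrow> complex \<times> complex"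
  where "pmap f1 f2 z = (eval2 f1 z, eval2 f2 z)"

definition keller :: "complex poly poly \<Rightarrow> complex poly poly \<Rightarrow> bool" where
  "keller f1 f2 \<longleftrightarrow> pd1 f1 * pd2 f2 - pd2 f1 * pd1 f2 = 1"


section \<open>The finiteness variety and its components\<close>

definition finiteness_variety ::
  "(complex \<times> complex \<Rightarrow> complex \<times> complex) \<Rightarrow> (complex \<times> complex) set" where
  "finiteness_variety f =
     {y. \<not> (\<exists>U. open U \<and> y \<in> U \<and> proper_map (top_of_set (f -` U)) (top_of_set U) f)}"

definition zariski :: "(complex \<times> complex) topology" where
  "zariski = topology_generated_by (range (\<lambda>p. {z. eval2 p z \<noteq> 0}))"

definition irreducible_in :: "'a topology \<Rightarrow> 'a set \<Rightarrow> bool" where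
  "irreducible_in T S \<longleftrightarrow> S \<subseteq> topspace T \<and> S \<noteq> {} \<and>
     (\<forall>A B. closedin T A \<and> closedin T B \<and> S \<subseteq> A \<union> B \<longrightarrow> S \<subseteq> A \<or> S \<subseteq> B)"

definition irreducible_component :: "'a topology \<Rightarrow> 'a set \<Rightarrow> 'a set \<Rightarrow> bool" where
  "irreducible_component T A V \<longleftrightarrow> irreducible_in T V \<and> V \<subseteq> A \<and>
     (\<forall>W. irreducible_in T W \<and> V \<subseteq> W \<and> W \<subseteq> A \<longrightarrow> W = V)"

text \<open>The whole plane is irreducible, so codimension one means that \<open>V\<close> is a proper subset with
  nothing irreducible and closed strictly between it and the plane.\<close>

definition codim_one :: "(complex \<times> complex) set \<Rightarrow> bool" where
  "codim_one V \<longleftrightarrow> closedin zariski V \<and> irreducible_in zariski V \<and> V \<noteq> UNIV \<and>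
     (\<forall>W. closedin zariski W \<and> irreducible_in zariski W \<and> V \<subseteq> W \<longrightarrow> W = V \<or> W = UNIV)"


section \<open>Irreducible curves over infinity on iterated point blowups of the projective plane\<close>

text \<open>A composition of point blowups over the line at infinity is described by affine charts
  \<open>(s, t)\<close>. A chart is recorded as a polynomial map \<open>\<phi>\<close> to the chart \<open>(1/x1, x2/x1)\<close> of the
  projective plane, in which the line at infinity is given by the vanishing of the first
  coordinate. In every chart generated below, the line \<open>s = 0\<close> is an irreducible curve \<open>\<Gamma>\<close> over
  infinity: it is the line at infinity itself for the identity chart, and the exceptional curve of
  the last blowup for the others. The centre \<open>(c, d)\<close> of a blowup may be any point over infinity of
  the current chart, and the two rules are the two standard charts of the blowup at this point.
  Blowups at points not lying under \<open>\<Gamma>\<close>, and blowups at points of \<open>\<Gamma>\<close>, change nothing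
  near a generic point of \<open>\<Gamma>\<close>, and need not be recorded.\<close>

inductive blowup_chart :: "(complex \<times> complex \<Rightarrow> complex \<times> complex) \<Rightarrow> bool" where
  base: "blowup_chart (\<lambda>z. z)"
| blowup1: "\<lbrakk>blowup_chart \<phi>; fst (\<phi> (c, d)) = 0\<rbrakk> \<Longrightarrow> blowup_chart (\<lambda>(s, t). \<phi> (c + s, d + s * t))"
| blowup2: "\<lbrakk>blowup_chart \<phi>; fst (\<phi> (c, d)) = 0\<rbrakk> \<Longrightarrow> blowup_chart (\<lambda>(s, t). \<phi> (c + s * t, d + s))"

text \<open>\<open>\<Gamma>\<close> is contracted to the point \<open>[1 : \<alpha> : 0]\<close> of the line at infinity, where
  the homogeneous coordinates are ordered such that \<open>(x1, x2)\<close> is the point \<open>[x1 : x2 : 1]\<close>.\<close>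

definition maps_to_point :: "(complex \<times> complex \<Rightarrow> complex \<times> complex) \<Rightarrow> complex \<Rightarrow> bool" where
  "maps_to_point \<phi> \<alpha> \<longleftrightarrow> (\<forall>t. \<phi> (0, t) = (0, \<alpha>))"

text \<open>The affine coordinates \<open>(x1, x2)\<close> of a point given by \<open>(1/x1, x2/x1)\<close>.\<close>

definition to_affine :: "complex \<times> complex \<Rightarrow> complex \<times> complex" where
  "to_affine = (\<lambda>(\<xi>, \<eta>). (1 / \<xi>, \<eta> / \<xi>))"

text \<open>In the chart \<open>\<phi>\<close>, \<open>f\<close> is given by the rational functions \<open>p1/q\<close> and \<open>p2/q\<close>, whose
  denominator does not vanish identically on \<open>\<Gamma>\<close>, and the image of \<open>\<Gamma>\<close> is dense in \<open>V\<close>.\<close>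

definition maps_densely_onto ::
  "(complex \<times> complex \<Rightarrow> complex \<times> complex) \<Rightarrow> (complex \<times> complex \<Rightarrow> complex \<times> complex)
     \<Rightarrow> (complex \<times> complex) set \<Rightarrow> bool" where
  "maps_densely_onto f \<phi> V \<longleftrightarrow> (\<exists>p1 p2 q.
     (\<exists>t. eval2 q (0, t) \<noteq> 0) \<and>
     (\<forall>z. fst (\<phi> z) \<noteq> 0 \<and> eval2 q z \<noteq> 0 \<longrightarrow>
        f (to_affine (\<phi> z)) = (eval2 p1 z / eval2 q z, eval2 p2 z / eval2 q z)) \<and>
     zariski closure_of
       {(eval2 p1 (0, t) / eval2 q (0, t), eval2 p2 (0, t) / eval2 q (0, t)) | t. eval2 q (0, t) \<noteq> 0}
     = V)"


section \<open>The u-gamma representation\<close>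

definition vanishing_order :: "(complex \<times> complex \<Rightarrow> complex) \<Rightarrow> nat \<Rightarrow> bool" where
  "vanishing_order g m \<longleftrightarrow>
     (\<exists>p. (\<forall>s t. g (s, t) = s ^ m * eval2 p (s, t)) \<and> (\<exists>t. eval2 p (0, t) \<noteq> 0))"

text \<open>Holomorphic in both variables; on an open set this is the same as being continuous and
  separately holomorphic (Osgood).\<close>

definition holomorphic2_on ::
  "(complex \<times> complex \<Rightarrow> complex) \<Rightarrow> (complex \<times> complex) set \<Rightarrow> bool" where
  "holomorphic2_on g U \<longleftrightarrow> continuous_on U g \<and>
     (\<forall>t. (\<lambda>s. g (s, t)) holomorphic_on {s. (s, t) \<in> U}) \<and>
     (\<forall>s. (\<lambda>t. g (s, t)) holomorphic_on {t. (s, t) \<in> U})"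

text \<open>\<open>m\<close> is the order of vanishing of \<open>1/x1\<close> along \<open>\<Gamma>\<close>. Near the point \<open>(0, t0)\<close> of
  \<open>\<Gamma>\<close>, \<open>\<sigma>\<close> is the local function with \<open>\<sigma>\<^sup>m = 1/x1\<close>. The nonvanishing derivative says that
  the point is generic: \<open>(\<sigma>, t)\<close> are local coordinates there, and \<open>x2/x1\<close> is expanded in them.
  Then \<open>N\<close> is the first index with a nonconstant coefficient, and the earlier coefficients are
  the constants \<open>h i\<close>.\<close>

definition u_gamma_data ::
  "(complex \<times> complex \<Rightarrow> complex \<times> complex) \<Rightarrow> nat \<Rightarrow> nat \<Rightarrow> (nat \<Rightarrow> complex) \<Rightarrow> bool" where
  "u_gamma_data \<phi> m N h \<longleftrightarrow> m \<ge> 1 \<and> vanishing_order (\<lambda>z. fst (\<phi> z)) m \<and>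
     (\<exists>t0 \<epsilon> \<sigma> \<beta>. \<epsilon> > 0 \<and>
        holomorphic2_on \<sigma> (ball 0 \<epsilon> \<times> ball t0 \<epsilon>) \<and>
        (\<forall>t\<in>ball t0 \<epsilon>. deriv (\<lambda>s. \<sigma> (s, t)) 0 \<noteq> 0) \<and>
        (\<forall>i. \<beta> i holomorphic_on ball t0 \<epsilon>) \<and>
        (\<forall>s\<in>ball 0 \<epsilon>. \<forall>t\<in>ball t0 \<epsilon>.
           \<sigma> (s, t) ^ m = fst (\<phi> (s, t)) \<and>
           (\<lambda>i. \<beta> i t * \<sigma> (s, t) ^ i) sums snd (\<phi> (s, t))) \<and>
        (\<forall>i<N. \<forall>t\<in>ball t0 \<epsilon>. \<beta> i t = h i) \<and>
        \<not> \<beta> N constant_on ball t0 \<epsilon>)"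

definition C_hat :: "nat \<Rightarrow> nat \<Rightarrow> (nat \<Rightarrow> complex) \<Rightarrow> complex \<Rightarrow> complex \<Rightarrow> complex \<times> complex" where
  "C_hat m N h \<gamma> u =
     (u ^ m, (\<Sum>i<N. h i * u powi (int m - int i)) + \<gamma> * u powi (int m - int N))"


section \<open>Trajectories\<close>

text \<open>The parameter \<open>r\<close> ranges over a set \<open>S\<close> of complex numbers and derivatives are taken within
  \<open>S\<close>. An open \<open>S\<close> gives trajectories in complex time, an interval of the real line gives
  trajectories in real time.\<close>

definition trajectory ::
  "complex poly poly \<Rightarrow> complex set \<Rightarrow> (complex \<Rightarrow> complex) \<Rightarrow> (complex \<Rightarrow> complex) \<Rightarrow> bool" where
  "trajectory f2 S x1 x2 \<longleftrightarrow> (\<forall>r\<in>S.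
     (x1 has_field_derivative eval2 (pd2 f2) (x1 r, x2 r)) (at r within S) \<and>
     (x2 has_field_derivative - eval2 (pd1 f2) (x1 r, x2 r)) (at r within S))"

end

theory Submission
  imports Defs
begin

lemma eval2_pCons: "eval2 (pCons c p) (x, y) = poly c y + x * eval2 p (x, y)"
  by (simp add: eval2_def)

lemma pd1_pCons: "pd1 (pCons c p) = p + pCons 0 (pd1 p)"
  by (simp add: pd1_def pderiv_pCons)

lemma pd2_pCons: "pd2 (pCons c p) = pCons (pderiv c) (pd2 p)"
  by (simp add: pd2_def map_poly_pCons)

lemma eval2_add: "eval2 (p + q) z = eval2 p z + eval2 q z"
  by (cases z) (simp add: eval2_def)

text \<open>Induction along the Horner form in the outer variable: \<open>pCons c p\<close>
  evaluates to the value of \<open>c\<close> at \<open>Y\<close> plus \<open>X\<close> times the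
  value of \<open>p\<close>, so the one-variable chain rule for \<open>c\<close> and the product
  rule with the induction hypothesis suffice. It later yields both partial derivatives of
  \<open>b\<close>.\<close>

lemma has_field_derivative_eval2:
  assumes X: "(X has_field_derivative X') (at t within S)"
    and Y: "(Y has_field_derivative Y') (at t within S)"
  shows "((\<lambda>t. eval2 p (X t, Y t)) has_field_derivative
           eval2 (pd1 p) (X t, Y t) * X' + eval2 (pd2 p) (X t, Y t) * Y') (at t within S)"
proof (induction p)
  case 0
  then show ?case by (simp add: eval2_def pd1_def pd2_def)
next
  case (pCons c p)
  have "((\<lambda>t. poly c (Y t)) has_field_derivative poly (pderiv c) (Y t) * Y') (at t within S)"
    by (rule DERIV_chain2[OF poly_DERIV Y])
  from DERIV_add[OF this DERIV_mult[OF X pCons.IH]] show ?case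
    by (simp add: eval2_pCons pd1_pCons pd2_pCons eval2_add algebra_simps)
qed

text \<open>Divide \<open>x y - x r = (u y - u r) * (\<Sum>i<m. u r ^ (m - 1 - i) * u y ^ i)\<close> by \<open>y - r\<close>: the last
  factor tends to \<open>m * u r ^ (m - 1)\<close>, which does not vanish.\<close>

lemma has_field_derivative_root_branch:
  fixes u x :: "'a::real_normed_field \<Rightarrow> 'a"
  assumes x: "(x has_field_derivative x') (at r within S)"
    and u: "continuous (at r within S) u"
    and root: "\<And>y. y \<in> S \<Longrightarrow> u y ^ m = x y"
    and r: "r \<in> S" "u r \<noteq> 0" and m: "m \<ge> 1"
  shows "(u has_field_derivative x' / (of_nat m * u r ^ (m - 1))) (at r within S)"
proof -
  define Q where "Q y = (\<Sum>i<m. u r ^ (m - Suc i) * u y ^ i)" for y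
  have "(u \<longlongrightarrow> u r) (at r within S)"
    using u by (simp add: continuous_within)
  then have "(Q \<longlongrightarrow> Q r) (at r within S)"
    unfolding Q_def by (intro tendsto_intros)
  \<comment> \<open>At \<open>y = r\<close> the exponents \<open>m - Suc i\<close> and
    \<open>i\<close> add up to \<open>m - 1\<close> in each of the \<open>m\<close>
    summands.\<close>
  moreover have Qr: "Q r = of_nat m * u r ^ (m - 1)"
    by (simp add: Q_def flip: power_add)
  moreover have nz: "of_nat m * u r ^ (m - 1) \<noteq> 0"
    using r m by simp
  ultimately have lim: "(Q \<longlongrightarrow> of_nat m * u r ^ (m - 1)) (at r within S)"
    by simp
  have in_S: "\<forall>\<^sub>F y in at r within S. y \<in> S \<and> y \<noteq> r"
    by (simp add: eventually_at_filter)
  have "((\<lambda>y. (x y - x r) / (y - r) / Q y) \<longlongrightarrow> x' / (of_nat m * u r ^ (m - 1))) (at r within S)"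
    using x lim nz by (intro tendsto_divide) (simp_all add: has_field_derivative_iff)
  moreover have "\<forall>\<^sub>F y in at r within S. (x y - x r) / (y - r) / Q y = (u y - u r) / (y - r)"
    using tendsto_imp_eventually_ne[OF lim nz] in_S
  proof eventually_elim
    case (elim y)
    then have "x y - x r = (u y - u r) * Q y"
      using root r(1) power_diff_sumr2[of "u y" m "u r"] by (simp add: Q_def)
    with elim show ?case by simp
  qed
  ultimately show ?thesis
    by (simp add: has_field_derivative_iff tendsto_cong)
qed

theorem corollary1:
  fixes f1 f2 :: "complex poly poly"
    and V :: "(complex \<times> complex) set"
    and \<phi> :: "complex \<times> complex \<Rightarrow> complex \<times> complex"
    and \<alpha> :: complex
    and m N :: nat
    and h :: "nat \<Rightarrow> complex"
    and a b \<psi>1 b_u :: "complex \<Rightarrow> complex \<Rightarrow> complex"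
    and L :: int
    and S :: "complex set"
    and x1 x2 u \<gamma> :: "complex \<Rightarrow> complex"
  assumes "keller f1 f2"
    and "irreducible_component zariski (finiteness_variety (pmap f1 f2)) V"
    and "codim_one V"
    and "blowup_chart \<phi>"
    and "maps_to_point \<phi> \<alpha>"
    and "maps_densely_onto (pmap f1 f2) \<phi> V"
    and "u_gamma_data \<phi> m N h"
    and "\<And>g v. v \<noteq> 0 \<Longrightarrow> pmap f1 f2 (C_hat m N h g v) = (a g v, b g v)"
    and "\<And>g v. v \<noteq> 0 \<Longrightarrow> \<psi>1 g v = deriv (\<lambda>g'. b g' v) g"
    and "\<And>g v. v \<noteq> 0 \<Longrightarrow> b_u g v = deriv (\<lambda>v'. b g v') v"
    and "L = int N - int m"
    and "trajectory f2 S x1 x2"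
    and "\<And>r. r \<in> S \<Longrightarrow> x1 r \<noteq> 0"
    and "continuous_on S u"
    and "\<And>r. r \<in> S \<Longrightarrow> u r ^ m = x1 r"
    and "\<And>r. r \<in> S \<Longrightarrow> (x1 r, x2 r) = C_hat m N h (\<gamma> r) (u r)"
  shows "\<forall>r\<in>S.
    (u has_field_derivative
       (1 / of_nat m) * u r powi (L - int m + 1) * \<psi>1 (\<gamma> r) (u r)) (at r within S) \<and>
    (\<gamma> has_field_derivative
       - (1 / of_nat m) * u r powi (L - int m + 1) * b_u (\<gamma> r) (u r)) (at r within S)"
proof
  fix r assume r: "r \<in> S"
  \<comment> \<open>\<open>G\<close> collects the part of the second coordinate of
    \<open>C_hat\<close> that is free of \<gamma>; what remains is linear in \<gamma>, so \<gamma>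
    can later be solved for.\<close>
  define G where "G v = (\<Sum>i<N. h i * v powi (int m - int i))" for v
  define G' where "G' v = (\<Sum>i<N. h i * (of_int (int m - int i) * v powi (int m - int i - 1)))" for v
  have m: "m \<ge> 1"
    using assms(7) by (simp add: u_gamma_data_def)
  \<comment> \<open>Since \<open>m \<ge> 1\<close>, a zero of \<open>u\<close> would be a zero of
    \<open>x1\<close>. Hence the possibly negative powers of \<open>u\<close> below are genuine
    reciprocals and never the default value at 0.\<close>
  have unz: "u y \<noteq> 0" if "y \<in> S" for y
    using assms(13)[OF that] assms(15)[OF that] m by (metis power_0_left not_one_le_zero)
  have dG: "(G has_field_derivative G' v) (at v)" if "v \<noteq> 0" for v
    unfolding G_def G'_def by (rule DERIV_sum) (auto intro!: derivative_eq_intros that)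
  have b: "b g v = eval2 f2 (v ^ m, G v + g * v powi (int m - int N))" if "v \<noteq> 0" for g v
    using assms(8)[OF that, of g] by (simp add: pmap_def C_hat_def G_def)
  have x1: "x1 y = u y ^ m" and x2: "x2 y = G (u y) + \<gamma> y * u y powi (int m - int N)" if "y \<in> S" for y
    using assms(16)[OF that] by (simp_all add: C_hat_def G_def)
  define U where "U = u r"
  define g where "g = \<gamma> r"
  define A where "A = eval2 (pd1 f2) (x1 r, x2 r)"
  define B where "B = eval2 (pd2 f2) (x1 r, x2 r)"
  define P where "P = U powi (int m - int N)"
  have U: "U \<noteq> 0" using unz r by (simp add: U_def)
  then have P: "P \<noteq> 0" by (simp add: P_def)
  have mnz: "(of_nat m :: complex) \<noteq> 0" using m by simp
  have at_r: "(U ^ m, G U + g * P) = (x1 r, x2 r)"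
    using x1[OF r] x2[OF r] by (simp add: U_def g_def P_def)

  \<comment> \<open>With \<open>u\<close> fixed, the first coordinate is constant, hence the factor
    0, and the second is affine in \<gamma> with slope \<open>P\<close>.\<close>
  have "((\<lambda>g'. eval2 f2 (U ^ m, G U + g' * P)) has_field_derivative
           eval2 (pd1 f2) (U ^ m, G U + g * P) * 0 + eval2 (pd2 f2) (U ^ m, G U + g * P) * P) (at g)"
    by (rule has_field_derivative_eval2) (auto intro!: derivative_eq_intros)
  then have \<psi>: "\<psi>1 g U = B * P"
    using assms(9)[OF U, of g] b[OF U] DERIV_imp_deriv at_r by (simp add: B_def P_def)

  \<comment> \<open>\<open>D\<close> is the derivative of the second coordinate of
    \<open>C_hat\<close> in \<open>u\<close> at fixed \<gamma>.\<close>
  define D where "D = G' U + g * (of_int (int m - int N) * U powi (int m - int N - 1))"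
  have "((\<lambda>v. eval2 f2 (v ^ m, G v + g * v powi (int m - int N))) has_field_derivative
           eval2 (pd1 f2) (U ^ m, G U + g * P) * (of_nat m * U ^ (m - 1))
         + eval2 (pd2 f2) (U ^ m, G U + g * P) * D) (at U)"
    unfolding P_def D_def
    by (rule has_field_derivative_eval2) (auto intro!: derivative_eq_intros dG simp: U)
  \<comment> \<open>The formula for \<open>b\<close> is known only for \<open>v \<noteq> 0\<close>;
    this set is open and contains \<open>U\<close>, so the derivative carries over.\<close>
  then have "((\<lambda>v. b g v) has_field_derivative A * (of_nat m * U ^ (m - 1)) + B * D) (at U)"
    unfolding at_r A_def[symmetric] B_def[symmetric]
    by (rule has_field_derivative_transform_within_open[where S = "- {0}"]) (auto simp: U b)
  then have bu: "b_u g U = A * (of_nat m * U ^ (m - 1)) + B * D"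
    using assms(10)[OF U, of g] DERIV_imp_deriv by simp

  have dx1: "(x1 has_field_derivative B) (at r within S)"
    and dx2: "(x2 has_field_derivative - A) (at r within S)"
    using assms(12) r by (simp_all add: trajectory_def A_def B_def)
  \<comment> \<open>Differentiating \<open>u ^ m = x1\<close> along the trajectory forces this
    value. As \<open>u\<close> is only assumed continuous, its differentiability comes from the
    lemma on root branches.\<close>
  define u' where "u' = B / (of_nat m * U ^ (m - 1))"
  have du: "(u has_field_derivative u') (at r within S)"
    unfolding u'_def U_def
    using dx1 assms(14) r unz[OF r] m
    by (intro has_field_derivative_root_branch[where x = x1])
      (auto simp: x1 continuous_on_eq_continuous_within)

  \<comment> \<open>The Jacobian determinant of \<open>C_hat\<close> in the order
    \<open>(u, \<gamma>)\<close> is \<open>of_nat m * U ^ (m - 1) * P\<close>, because the first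
    coordinate does not involve \<gamma>. The factor in the claim is its reciprocal, as expected
    when a Hamiltonian system is rewritten in new coordinates.\<close>
  have powN: "U powi (L - int m + 1) = 1 / (P * U ^ (m - 1))"
  proof -
    have "L - int m + 1 = - (int m - int N) - int (m - 1)"
      using m assms(11) by simp
    then have "U powi (L - int m + 1) = U powi (- (int m - int N)) / U powi int (m - 1)"
      using U by (metis power_int_diff)
    then show ?thesis
      unfolding power_int_minus P_def[symmetric] power_int_of_nat
      by (simp add: divide_inverse)
  qed
  have u_eq: "u' = (1 / of_nat m) * U powi (L - int m + 1) * \<psi>1 g U"
    unfolding powN \<psi> u'_def using U P by (simp add: field_simps)

  \<comment> \<open>No regularity of \<gamma> is assumed. Expressing it through \<open>x2\<close>
    and \<open>u\<close>, which are differentiable at \<open>r\<close>, supplies its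
    derivative.\<close>
  have "\<gamma> y = (x2 y - G (u y)) * u y powi (int N - int m)" if "y \<in> S" for y
  proof -
    have "u y powi (int m - int N) * u y powi (int N - int m) = 1"
      using unz[OF that] by (simp flip: power_int_add)
    then show ?thesis by (simp add: x2[OF that] mult.assoc)
  qed
  moreover have "((\<lambda>y. (x2 y - G (u y)) * u y powi (int N - int m)) has_field_derivative
      (- A - G' U * u') * U powi (int N - int m)
      + (of_int (int N - int m) * U powi (int N - int m - 1) * u') * (x2 r - G U)) (at r within S)"
    using U unfolding U_def
    by (auto intro!: derivative_eq_intros dx2 du DERIV_chain2[OF dG])
  \<comment> \<open>The formula for \<gamma> holds on all of \<open>S\<close>, so the radius 1 of
    the neighbourhood is arbitrary.\<close>
  ultimately have "(\<gamma> has_field_derivative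
      (- A - G' U * u') * U powi (int N - int m)
      + (of_int (int N - int m) * U powi (int N - int m - 1) * u') * (x2 r - G U)) (at r within S)"
    using r by (auto intro: has_field_derivative_transform_within[OF _ zero_less_one])
  \<comment> \<open>Both sides equal \<open>- (A + D * u') / P\<close>: on the left, replacing
    \<open>x2 r - G U\<close> by \<open>g * P\<close> makes the terms with \<open>u'\<close> combine
    to \<open>D\<close>; on the right, dividing \<open>b_u\<close> by the Jacobian determinant turns
    \<open>B\<close> into \<open>u'\<close>.\<close>
  also have "(- A - G' U * u') * U powi (int N - int m)
      + (of_int (int N - int m) * U powi (int N - int m - 1) * u') * (x2 r - G U)
    = - (1 / of_nat m) * U powi (L - int m + 1) * b_u g U"
  proof -
    have p1: "U powi (int N - int m) = 1 / P"
      by (simp add: P_def flip: power_int_minus_divide)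
    then have p2: "U powi (int N - int m - 1) = 1 / (P * U)"
      using U by (simp add: power_int_diff)
    have p3: "U powi (int m - int N - 1) = P / U"
      using U by (simp add: P_def power_int_diff)
    have p4: "x2 r - G U = g * P"
      using at_r by (simp add: eq_diff_eq' algebra_simps)
    show ?thesis
      unfolding powN bu D_def u'_def p1 p2 p3 p4 using U P mnz by (simp add: field_simps)
  qed
  finally show "(u has_field_derivative
       (1 / of_nat m) * u r powi (L - int m + 1) * \<psi>1 (\<gamma> r) (u r)) (at r within S) \<and>
    (\<gamma> has_field_derivative
       - (1 / of_nat m) * u r powi (L - int m + 1) * b_u (\<gamma> r) (u r)) (at r within S)"
    using du u_eq by (simp add: U_def g_def)
qed

end
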